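(* Let $k$ be an algebraically closed field of characteristic $2$ and let $m\ge 1$. (i) The algebra $R_{2\times m}^{O(2)}$ is generated by the invariants $Q^{(i)}$ with $1\le i\le m$ and $B^{(i_1,\dots,i_s|j_1,\dots,j_s)}$ with $s\ge 1$ and $1\le i_1<\dots<i_s<j_1<\dots<j_s\le m$. (ii) The system of generators in (i) is minimal. Indeed, any system of multi-homogeneous generators of the algebra $R_{2\times m}^{O(2)}$ must contain each of the invariants $Q^{(i)}$ (possibly multiplied by non-zero constants), and must contain an invariant of multi-degree $\alpha$ for every $0$-$1$ sequence $\alpha=(\alpha^{(1)},\dots,\alpha^{(m)})$ that contains a positive even number of $1$'s.
   Context: $k$ is an algebraically closed field of characteristic $2$. $O(2)$ is the group of linear automorphisms of $k^2$ (coordinates $x,y$) preserving the quadratic form $q=xy$. $R_{2\times m}=k[x^{(i)},y^{(i)}:1\le i\le m]$ is the algebra of polynomials in the coordinates of $m$ indeterminate vectors $v^{(i)}=(x^{(i)},y^{(i)})$, with $O(2)$ acting diagonally on $m$-tuples of vectors; $R_{2\times m}^{O(2)}$ is the subalgebra of invariants. The multi-degree of a monomial is $\alpha=(\alpha^{(1)},\dots,\alpha^{(m)})$, where $\alpha^{(i)}$ is its total degree in the variables belonging to $v^{(i)}$; a polynomial is multi-homogeneous if all its monomials have the same multi-degree. Notation: $Q^{(i)}=x^{(i)}y^{(i)}$, and $$B^{(i_1,\dots,i_s|j_1,\dots,j_s)}=x^{(i_1)}\cdots x^{(i_s)}y^{(j_1)}\cdots y^{(j_s)}+y^{(i_1)}\cdots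 y^{(i_s)}x^{(j_1)}\cdots x^{(j_s)}.$$ These are elements of $R_{2\times m}^{O(2)}$. *)

theory Defs
  imports
    "HOL-Analysis.Analysis"
    "HOL-Library.Poly_Mapping"
    "HOL-Computational_Algebra.Polynomial"
begin

text \<open>\<open>VX i\<close> and \<open>VY i\<close> are the coordinates \<open>x\<^sup>(\<^sup>i\<^sup>)\<close>, \<open>y\<^sup>(\<^sup>i\<^sup>)\<close> of the \<open>i\<close>-th indeterminate vector.\<close>

datatype var = VX nat | VY nat

fun vec_index :: "var \<Rightarrow> nat" where
  "vec_index (VX i) = i"
| "vec_index (VY i) = i"

type_synonym 'k mpoly = "(var \<Rightarrow>\<^sub>0 nat) \<Rightarrow>\<^sub>0 'k"

definition Const :: "'k::comm_ring_1 \<Rightarrow> 'k mpoly" where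
  "Const c = Poly_Mapping.single 0 c"

definition Var :: "var \<Rightarrow> 'k::comm_ring_1 mpoly" where
  "Var v = Poly_Mapping.single (Poly_Mapping.single v 1) 1"

text \<open>The vectors are numbered from \<open>1\<close>; \<open>poly_ring m\<close> is the polynomial algebra
  in the coordinates of the vectors \<open>1, \<dots>, m\<close>.\<close>

definition poly_ring :: "nat \<Rightarrow> 'k::comm_ring_1 mpoly set" where
  "poly_ring m = {p. \<forall>t \<in> Poly_Mapping.keys p. \<forall>v \<in> Poly_Mapping.keys t. vec_index v \<in> {1..m}}"

definition poly_subst :: "(var \<Rightarrow> 'k mpoly) \<Rightarrow> 'k::comm_ring_1 mpoly \<Rightarrow> 'k mpoly" where
  "poly_subst \<sigma> p =
     (\<Sum>t \<in> Poly_Mapping.keys p. Const (Poly_Mapping.lookup p t) *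
        (\<Prod>v \<in> Poly_Mapping.keys t. \<sigma> v ^ Poly_Mapping.lookup t v))"

definition quad_form :: "'k::field ^ 2 \<Rightarrow> 'k" where
  "quad_form v = v $ 1 * v $ 2"

text \<open>Linear automorphisms of \<open>k\<^sup>2\<close> are represented by their matrices.\<close>

definition O2 :: "('k::field ^ 2 ^ 2) set" where
  "O2 = {A. invertible A \<and> (\<forall>v. quad_form (A *v v) = quad_form v)}"

text \<open>The coordinates of \<open>A v\<^sup>(\<^sup>i\<^sup>)\<close> as linear forms. Substituting them into \<open>p\<close> gives
  \<open>p (A v\<^sup>(\<^sup>1\<^sup>), \<dots>, A v\<^sup>(\<^sup>m\<^sup>))\<close>. This is the action of the inverse of \<open>A\<close> on \<open>p\<close>; since
  invariance is required for all elements of the group, the inverse is immaterial.\<close>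

fun coord_image :: "'k::field ^ 2 ^ 2 \<Rightarrow> var \<Rightarrow> 'k mpoly" where
  "coord_image A (VX i) = Const (A $ 1 $ 1) * Var (VX i) + Const (A $ 1 $ 2) * Var (VY i)"
| "coord_image A (VY i) = Const (A $ 2 $ 1) * Var (VX i) + Const (A $ 2 $ 2) * Var (VY i)"

definition invariants :: "nat \<Rightarrow> 'k::field mpoly set" where
  "invariants m = {p \<in> poly_ring m. \<forall>A \<in> O2. poly_subst (coord_image A) p = p}"

definition subalgebra :: "'k::comm_ring_1 mpoly set \<Rightarrow> bool" where
  "subalgebra S \<longleftrightarrow> range Const \<subseteq> S \<and> (\<forall>p \<in> S. \<forall>q \<in> S. p + q \<in> S \<and> p * q \<in> S)"

definition generates :: "'k::comm_ring_1 mpoly set \<Rightarrow> 'k mpoly set \<Rightarrow> bool" where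
  "generates G S \<longleftrightarrow> subalgebra hull G = S"

definition minimally_generates :: "'k::comm_ring_1 mpoly set \<Rightarrow> 'k mpoly set \<Rightarrow> bool" where
  "minimally_generates G S \<longleftrightarrow> generates G S \<and> (\<forall>H. H \<subset> G \<longrightarrow> \<not> generates H S)"

definition mono_multideg :: "(var \<Rightarrow>\<^sub>0 nat) \<Rightarrow> nat \<Rightarrow> nat" where
  "mono_multideg t i = Poly_Mapping.lookup t (VX i) + Poly_Mapping.lookup t (VY i)"

text \<open>The zero polynomial is multi-homogeneous, but has no multi-degree. A multi-degree
  \<open>\<alpha>\<close> is a function of which only the values on \<open>{1..m}\<close> matter.\<close>

definition multihomogeneous :: "nat \<Rightarrow> 'k::comm_ring_1 mpoly \<Rightarrow> bool" where
  "multihomogeneous m p \<longleftrightarrow>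
     (\<forall>s \<in> Poly_Mapping.keys p. \<forall>t \<in> Poly_Mapping.keys p. \<forall>i \<in> {1..m}.
        mono_multideg s i = mono_multideg t i)"

definition has_multidegree :: "nat \<Rightarrow> 'k::comm_ring_1 mpoly \<Rightarrow> (nat \<Rightarrow> nat) \<Rightarrow> bool" where
  "has_multidegree m p \<alpha> \<longleftrightarrow>
     p \<noteq> 0 \<and> (\<forall>t \<in> Poly_Mapping.keys p. \<forall>i \<in> {1..m}. mono_multideg t i = \<alpha> i)"

definition Q_inv :: "nat \<Rightarrow> 'k::comm_ring_1 mpoly" where
  "Q_inv i = Var (VX i) * Var (VY i)"

text \<open>The upper indices \<open>i\<^sub>1,\<dots>,i\<^sub>s\<close> and \<open>j\<^sub>1,\<dots>,j\<^sub>s\<close> of \<open>B\<close> are given as lists.\<close>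

definition B_inv :: "nat list \<Rightarrow> nat list \<Rightarrow> 'k::comm_ring_1 mpoly" where
  "B_inv il jl =
     (\<Prod>i\<leftarrow>il. Var (VX i)) * (\<Prod>j\<leftarrow>jl. Var (VY j)) +
     (\<Prod>i\<leftarrow>il. Var (VY i)) * (\<Prod>j\<leftarrow>jl. Var (VX j))"

definition gens :: "nat \<Rightarrow> 'k::comm_ring_1 mpoly set" where
  "gens m = {Q_inv i | i. i \<in> {1..m}} \<union>
     {B_inv il jl | il jl. length il = length jl \<and> length il \<ge> 1 \<and>
        sorted_wrt (<) (il @ jl) \<and> set (il @ jl) \<subseteq> {1..m}}"

end

theory Submission
  imports Defs
begin

text \<open>
  The group \<open>O(2)\<close> consists of the matrices \<open>diag(a, 1/a)\<close> and of their products with the swap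
  \<open>x \<leftrightarrow> y\<close>. Since \<open>k\<close> is infinite, invariance under the diagonal matrices says that every monomial of
  the polynomial is balanced, that is, has the same degree in the \<open>x\<close>- as in the \<open>y\<close>-variables; invariance under
  the swap says that a monomial and its swapped counterpart have equal coefficients. Hence the
  invariants are spanned by the balanced monomials that the swap fixes, which are the products of the
  \<open>Q\<close>'s, and by the orbit sums \<open>t + t'\<close>, where \<open>t\<close> is balanced and \<open>t'\<close> is its swap
  (\<open>invariants_iff\<close>).

  For the generation, the identity
  \<open>orb(x\<^sub>i y\<^sub>j) orb(t) = orb(x\<^sub>i y\<^sub>j t) + orb(x\<^sub>j y\<^sub>i t)\<close> shows that, modulo products of orbit sums of
  smaller degree and up to sign, the index of an \<open>x\<close> may be exchanged with the index of a \<open>y\<close>. An index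
  that occurs twice can so be brought to both sides, and then a factor \<open>Q\<close> splits off. In a
  multilinear monomial, exchanges bring all \<open>x\<close>-indices before all \<open>y\<close>-indices; the orbit
  sum has then become one of the \<open>B\<close>'s (\<open>orbit_sum_in_subalgebra\<close>).

  For the lower bounds, a linear functional \<open>\<lambda>\<close> on the invariants with \<open>\<lambda>(pq) = \<lambda>(p) q(0) + p(0) \<lambda>(q)\<close> vanishes on
  every subalgebra whose generators it kills. So if \<open>\<lambda> \<noteq> 0\<close>, every generating set contains an element
  on which \<open>\<lambda>\<close> is non-zero (\<open>exists_generator_detected\<close>). The coefficient of
  \<open>x\<^sub>i y\<^sub>i\<close> is such a functional, because an invariant has no linear terms; among the multi-homogeneous invariants
  it detects the multiples of \<open>Q\<^sub>i\<close>. Given a non-empty set \<open>D\<close> of indices, fix \<open>d \<in> D\<close>. For \<open>I \<subseteq> D\<close> let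
  \<open>x\<^sub>I y\<^sub>J\<close> with \<open>J = D - I\<close> be the product of the \<open>x\<close>'s with index in \<open>I\<close> and the \<open>y\<close>'s with index in \<open>J\<close>.
  The functional for \<open>D\<close> is the sum of the coefficients of all \<open>x\<^sub>I y\<^sub>J\<close> with \<open>d \<in> I\<close>. When a product
  \<open>pq\<close> is expanded, the factor that does not contain \<open>x\<^sub>d\<close> runs over monomials which may be
  swapped freely; a monomial and its swap contribute the same, so that in characteristic \<open>2\<close> everything
  cancels unless this factor is \<open>1\<close> (\<open>coeff_sum_squarefree_derivation\<close>). This functional takes the
  value \<open>1\<close> on every \<open>B\<close> with index set \<open>D\<close>, and it detects the multi-degree that is \<open>1\<close> on \<open>D\<close> and
  \<open>0\<close> elsewhere. The multi-degrees of the \<open>Q\<close>'s and \<open>B\<close>'s are pairwise different, and so none of these generators can be left out.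
\<close>

section \<open>Sums of terms, and substitution as a ring homomorphism\<close>

(* Exponents 1 of single variables occur everywhere and are to stay in the form 1, not Suc 0. *)
declare One_nat_def [simp del]

abbreviation keys :: "('a \<Rightarrow>\<^sub>0 'b::zero) \<Rightarrow> 'a set" where
  "keys \<equiv> Poly_Mapping.keys"

abbreviation lookup :: "('a \<Rightarrow>\<^sub>0 'b::zero) \<Rightarrow> 'a \<Rightarrow> 'b" where
  "lookup \<equiv> Poly_Mapping.lookup"

abbreviation single :: "'a \<Rightarrow> 'b \<Rightarrow> ('a \<Rightarrow>\<^sub>0 'b::zero)" where
  "single \<equiv> Poly_Mapping.single"

lemma poly_mapping_eq_sum_single:
  "p = (\<Sum>t\<in>keys p. single t (lookup p t))"
proof (rule poly_mapping_eqI)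
  fix k
  have "lookup (\<Sum>t\<in>keys p. single t (lookup p t)) k
     = (\<Sum>t\<in>keys p. if t = k then lookup p t else 0)"
    unfolding lookup_sum by (intro sum.cong) (auto simp: lookup_single when_def)
  also have "\<dots> = lookup p k"
    by (simp add: in_keys_iff)
  finally show "lookup p k = lookup (\<Sum>t\<in>keys p. single t (lookup p t)) k" ..
qed

lemma times_eq_sum_single:
  fixes p q :: "'k::comm_ring_1 mpoly"
  shows "p * q = (\<Sum>s\<in>keys p. \<Sum>t\<in>keys q.
           single (s + t) (lookup p s * lookup q t))"
  by (subst poly_mapping_eq_sum_single[of p], subst poly_mapping_eq_sum_single[of q])
     (simp add: sum_product mult_single)

definition mono_eval :: "(var \<Rightarrow> 'a) \<Rightarrow> (var \<Rightarrow>\<^sub>0 nat) \<Rightarrow> 'a::comm_monoid_mult" where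
  "mono_eval f t = (\<Prod>v\<in>keys t. f v ^ lookup t v)"

lemma mono_eval_superset:
  assumes "finite V" "keys t \<subseteq> V"
  shows "mono_eval f t = (\<Prod>v\<in>V. f v ^ lookup t v)"
  unfolding mono_eval_def using assms
  by (intro prod.mono_neutral_left) (auto simp: in_keys_iff)

lemma mono_eval_zero [simp]: "mono_eval f 0 = 1"
  by (simp add: mono_eval_def)

lemma mono_eval_add: "mono_eval f (s + t) = mono_eval f s * mono_eval f t"
proof -
  let ?V = "keys s \<union> keys t"
  have "mono_eval f (s + t) = (\<Prod>v\<in>?V. f v ^ lookup (s + t) v)"
    by (rule mono_eval_superset) (simp_all add: keys_add)
  also have "\<dots> = (\<Prod>v\<in>?V. f v ^ lookup s v) * (\<Prod>v\<in>?V. f v ^ lookup t v)"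
    by (simp add: lookup_add power_add prod.distrib)
  also have "\<dots> = mono_eval f s * mono_eval f t"
    by (simp add: mono_eval_superset[of ?V])
  finally show ?thesis .
qed

lemma mono_eval_single [simp]: "mono_eval f (single v n) = f v ^ n"
  by (cases "n = 0") (auto simp: mono_eval_def)

lemma mono_eval_times: "mono_eval (\<lambda>v. f v * g v) t = mono_eval f t * mono_eval g t"
  by (simp add: mono_eval_def power_mult_distrib prod.distrib)

lemma Const_zero [simp]: "Const 0 = 0"
  by (simp add: Const_def)

lemma Const_one [simp]: "Const 1 = 1"
  by (simp add: Const_def)

lemma Const_mult: "Const (a * b) = Const a * Const b"
  by (simp add: Const_def mult_single)

lemma Const_power: "Const (a ^ n) = Const a ^ n"
  by (induction n) (auto simp: Const_mult)

lemma lookup_Const_times [simp]: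
  "lookup (Const c * p) t = c * lookup p t"
  by (simp add: Const_def flip: mult_map_scale_conv_mult) (simp add: Poly_Mapping.map.rep_eq when_def)

lemma Const_times_single [simp]:
  "Const c * single t a = single t (c * a)"
  by (simp add: Const_def mult_single)

lemma poly_subst_superset:
  assumes "finite T" "keys p \<subseteq> T"
  shows "poly_subst \<sigma> p = (\<Sum>t\<in>T. Const (lookup p t) * mono_eval \<sigma> t)"
  unfolding poly_subst_def mono_eval_def using assms
  by (intro sum.mono_neutral_left) (auto simp: in_keys_iff)

lemma poly_subst_zero [simp]: "poly_subst \<sigma> 0 = 0"
  by (simp add: poly_subst_def)

lemma poly_subst_single [simp]:
  "poly_subst \<sigma> (single t c) = Const c * mono_eval \<sigma> t"
  by (subst poly_subst_superset[of "{t}"]) auto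

lemma poly_subst_add: "poly_subst \<sigma> (p + q) = poly_subst \<sigma> p + poly_subst \<sigma> q"
proof -
  let ?T = "keys p \<union> keys q"
  have "poly_subst \<sigma> (p + q) = (\<Sum>t\<in>?T. Const (lookup (p + q) t) * mono_eval \<sigma> t)"
    by (rule poly_subst_superset) (simp_all add: keys_add)
  also have "\<dots> = poly_subst \<sigma> p + poly_subst \<sigma> q"
    by (simp add: poly_subst_superset[of ?T] lookup_add Const_def single_add distrib_right sum.distrib)
  finally show ?thesis .
qed

lemma poly_subst_sum: "poly_subst \<sigma> (\<Sum>i\<in>I. f i) = (\<Sum>i\<in>I. poly_subst \<sigma> (f i))"
  by (induction I rule: infinite_finite_induct) (auto simp: poly_subst_add)

lemma poly_subst_times: "poly_subst \<sigma> (p * q) = poly_subst \<sigma> p * poly_subst \<sigma> q"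
  by (subst times_eq_sum_single)
     (simp add: poly_subst_sum mono_eval_add Const_mult mult_ac sum_product
        poly_subst_superset[of "keys p"] poly_subst_superset[of "keys q"])

section \<open>Monomials: the swap and degrees\<close>

fun swap_var :: "var \<Rightarrow> var" where
  "swap_var (VX i) = VY i"
| "swap_var (VY i) = VX i"

definition swap_mono :: "(var \<Rightarrow>\<^sub>0 nat) \<Rightarrow> (var \<Rightarrow>\<^sub>0 nat)" where
  "swap_mono t = Poly_Mapping.map_key swap_var t"

lemma swap_var_swap_var [simp]: "swap_var (swap_var v) = v"
  by (cases v) auto

lemma inj_swap_var: "inj swap_var"
  by (metis injI swap_var_swap_var)

lemma vec_index_swap_var [simp]: "vec_index (swap_var v) = vec_index v"
  by (cases v) auto

lemma lookup_swap_mono [simp]: "lookup (swap_mono t) v = lookup t (swap_var v)"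
  by (simp add: swap_mono_def map_key.rep_eq inj_swap_var)

lemma keys_swap_mono: "v \<in> keys (swap_mono t) \<longleftrightarrow> swap_var v \<in> keys t"
  by (simp add: in_keys_iff)

lemma swap_mono_swap_mono [simp]: "swap_mono (swap_mono t) = t"
  by (rule poly_mapping_eqI) simp

lemma swap_mono_add: "swap_mono (s + t) = swap_mono s + swap_mono t"
  by (rule poly_mapping_eqI) (simp add: lookup_add)

lemma swap_mono_zero [simp]: "swap_mono 0 = 0"
  by (rule poly_mapping_eqI) simp

lemma swap_mono_single [simp]:
  "swap_mono (single v n) = single (swap_var v) n"
  by (rule poly_mapping_eqI) (auto simp: lookup_single when_def)

text \<open>Every degree of a monomial used below (in the \<open>x\<close>'s, in the \<open>y\<close>'s, total, or weighted by the
  indices) is such a weight.\<close>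
definition weight :: "(var \<Rightarrow> nat) \<Rightarrow> (var \<Rightarrow>\<^sub>0 nat) \<Rightarrow> nat" where
  "weight w t = (\<Sum>v\<in>keys t. lookup t v * w v)"

lemma weight_superset:
  assumes "finite V" "keys t \<subseteq> V"
  shows "weight w t = (\<Sum>v\<in>V. lookup t v * w v)"
  unfolding weight_def using assms
  by (intro sum.mono_neutral_left) (auto simp: in_keys_iff)

lemma weight_zero [simp]: "weight w 0 = 0"
  by (simp add: weight_def)

lemma weight_single [simp]: "weight w (single v n) = n * w v"
  by (subst weight_superset[of "{v}"]) auto

lemma weight_add: "weight w (s + t) = weight w s + weight w t"
proof -
  let ?V = "keys s \<union> keys t"
  have "weight w (s + t) = (\<Sum>v\<in>?V. lookup (s + t) v * w v)"
    by (rule weight_superset) (simp_all add: keys_add)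
  then show ?thesis
    by (simp add: lookup_add distrib_right sum.distrib weight_superset[of ?V])
qed

definition xdeg :: "(var \<Rightarrow>\<^sub>0 nat) \<Rightarrow> nat" where
  "xdeg = weight (\<lambda>v. case v of VX _ \<Rightarrow> 1 | VY _ \<Rightarrow> 0)"

definition ydeg :: "(var \<Rightarrow>\<^sub>0 nat) \<Rightarrow> nat" where
  "ydeg = weight (\<lambda>v. case v of VX _ \<Rightarrow> 0 | VY _ \<Rightarrow> 1)"

lemma xdeg_zero [simp]: "xdeg 0 = 0"
  and ydeg_zero [simp]: "ydeg 0 = 0"
  and xdeg_add [simp]: "xdeg (s + t) = xdeg s + xdeg t"
  and ydeg_add [simp]: "ydeg (s + t) = ydeg s + ydeg t"
  and xdeg_single_VX [simp]: "xdeg (single (VX i) n) = n"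
  and xdeg_single_VY [simp]: "xdeg (single (VY i) n) = 0"
  and ydeg_single_VX [simp]: "ydeg (single (VX i) n) = 0"
  and ydeg_single_VY [simp]: "ydeg (single (VY i) n) = n"
  by (simp_all add: xdeg_def ydeg_def weight_add)

lemma weight_swap: "weight w (swap_mono t) = weight (w \<circ> swap_var) t"
proof -
  have "keys (swap_mono t) = swap_var ` keys t"
    by (auto simp: keys_swap_mono image_iff) (metis swap_var_swap_var)
  then show ?thesis
    unfolding weight_def
    by (simp add: sum.reindex inj_on_subset[OF inj_swap_var])
qed

lemma xdeg_swap_mono [simp]: "xdeg (swap_mono t) = ydeg t"
  unfolding xdeg_def ydeg_def weight_swap
  by (rule arg_cong[of _ _ "\<lambda>w. weight w t"])
    (auto split: var.splits simp: fun_eq_iff elim!: swap_var.elims)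

lemma ydeg_swap_mono [simp]: "ydeg (swap_mono t) = xdeg t"
  by (metis swap_mono_swap_mono xdeg_swap_mono)

lemma mono_split:
  fixes t :: "var \<Rightarrow>\<^sub>0 nat"
  assumes "v \<in> keys t"
  obtains t' where "t = single v 1 + t'"
proof
  show "t = single v 1 + (t - single v (1::nat))"
    using assms by (intro poly_mapping_eqI)
      (auto simp: lookup_add lookup_minus lookup_single when_def in_keys_iff)
qed

lemma mono_eval_Const: "mono_eval (\<lambda>v. Const (f v)) t = Const (mono_eval f t)"
proof -
  have "Const (\<Prod>v\<in>V. g v) = (\<Prod>v\<in>V. Const (g v))" for V :: "var set" and g :: "var \<Rightarrow> 'a"
    by (induction V rule: infinite_finite_induct) (auto simp: Const_mult)
  then show ?thesis by (simp add: mono_eval_def Const_power)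
qed

lemma mono_induct [case_names zero add]:
  assumes "P 0" and "\<And>v t. P t \<Longrightarrow> P (single v 1 + t)"
  shows "P (t :: var \<Rightarrow>\<^sub>0 nat)"
proof (induction "weight (\<lambda>_. 1) t" arbitrary: t rule: less_induct)
  case less
  show ?case
  proof (cases "t = 0")
    case False
    then obtain v where "v \<in> keys t" by (metis all_not_in_conv keys_eq_empty)
    then obtain t' where t: "t = single v 1 + t'" by (rule mono_split)
    have "P t'" by (rule less) (simp add: t weight_add)
    then show ?thesis using assms t by simp
  qed (use assms in simp)
qed

lemma mono_eval_Var: "mono_eval Var t = single t 1"
  by (induction t rule: mono_induct) (auto simp: mono_eval_add Var_def mult_single)

lemma mono_eval_Var_swap: "mono_eval (\<lambda>v. Var (swap_var v)) t = single (swap_mono t) 1"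
  by (induction t rule: mono_induct) (auto simp: mono_eval_add Var_def mult_single swap_mono_add)

lemma mono_eval_torus:
  "mono_eval (case_var (\<lambda>_. a) (\<lambda>_. b)) t = a ^ xdeg t * b ^ ydeg t"
proof (induction t rule: mono_induct)
  case (add v t)
  then show ?case by (cases v) (auto simp: mono_eval_add power_add mult_ac)
qed simp

section \<open>The orthogonal group and its invariants\<close>

definition torus_mat :: "'k::field \<Rightarrow> 'k^2^2" where
  "torus_mat a = vector [vector [a, 0], vector [0, inverse a]]"

definition swap_mat :: "'k::field \<Rightarrow> 'k^2^2" where
  "swap_mat a = vector [vector [0, a], vector [inverse a, 0]]"

lemma matrix_2_eq_iff:
  fixes A B :: "'a ^ 2 ^ 2"
  shows "A = B \<longleftrightarrow> A $ 1 $ 1 = B $ 1 $ 1 \<and> A $ 1 $ 2 = B $ 1 $ 2 \<and> A $ 2 $ 1 = B $ 2 $ 1 \<and> A $ 2 $ 2 = B $ 2 $ 2"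
  by (auto simp: vec_eq_iff forall_2)

lemma matrix_vec_2:
  fixes A :: "'k::field ^ 2 ^ 2"
  shows "(A *v v) $ i = A $ i $ 1 * v $ 1 + A $ i $ 2 * v $ 2"
  by (simp add: matrix_vector_mult_def sum_2)

lemma torus_mat_in_O2: "a \<noteq> 0 \<Longrightarrow> torus_mat a \<in> O2"
  unfolding O2_def
  by (auto simp: invertible_def quad_form_def matrix_vec_2 torus_mat_def
      matrix_matrix_mult_def vec_eq_iff forall_2 sum_2 mat_def field_simps
      intro!: exI[of _ "torus_mat (inverse a)"])

lemma swap_mat_in_O2: "a \<noteq> 0 \<Longrightarrow> swap_mat a \<in> O2"
  unfolding O2_def
  by (auto simp: invertible_def quad_form_def matrix_vec_2 swap_mat_def
      matrix_matrix_mult_def vec_eq_iff forall_2 sum_2 mat_def field_simps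
      intro!: exI[of _ "swap_mat a"])

text \<open>Comparing \<open>(a x + b y)(c x + d y)\<close> with \<open>x y\<close> at the points \<open>(1,0)\<close>, \<open>(0,1)\<close> and
  \<open>(1,1)\<close> gives \<open>a c = 0\<close>, \<open>b d = 0\<close> and \<open>a d + b c = 1\<close>, which leaves only these two shapes.\<close>
lemma O2_cases:
  assumes "A \<in> O2"
  obtains a where "a \<noteq> 0" "A = torus_mat a" | a where "a \<noteq> 0" "A = swap_mat a"
proof -
  have q: "(A $ 1 $ 1 * x + A $ 1 $ 2 * y) * (A $ 2 $ 1 * x + A $ 2 $ 2 * y) = x * y" for x y
    using assms unfolding O2_def quad_form_def matrix_vec_2
    by (auto dest: spec[of _ "vector [x, y]"])
  have 1: "A $ 1 $ 1 * A $ 2 $ 1 = 0" using q[of 1 0] by simp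
  have 2: "A $ 1 $ 2 * A $ 2 $ 2 = 0" using q[of 0 1] by simp
  have 3: "A $ 1 $ 1 * A $ 2 $ 2 + A $ 1 $ 2 * A $ 2 $ 1 = 1"
    using q[of 1 1] 1 2 by (simp add: algebra_simps)
  show thesis
  proof (cases "A $ 1 $ 1 = 0")
    case True
    then have "A $ 1 $ 2 * A $ 2 $ 1 = 1" using 3 by simp
    moreover from this have "A $ 1 $ 2 \<noteq> 0" by auto
    ultimately show thesis using that(2)[of "A $ 1 $ 2"] True 2
      by (auto simp: swap_mat_def matrix_2_eq_iff field_simps)
  next
    case False
    then have "A $ 2 $ 1 = 0" using 1 by simp
    then show thesis using that(1)[of "A $ 1 $ 1"] False 2 3
      by (auto simp: torus_mat_def matrix_2_eq_iff field_simps)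
  qed
qed

text \<open>If all non-zero \<open>a\<close> satisfied \<open>a\<^sup>n = 1\<close>, then the polynomial \<open>z (z\<^sup>n - 1) + 1\<close> would have no
  root. This supplies the elements of the torus that tell different exponents apart.\<close>
lemma alg_closed_power_neq_one:
  assumes "n > 0"
  obtains a :: "'k::alg_closed_field" where "a \<noteq> 0" "a ^ n \<noteq> 1"
proof -
  define p :: "'k poly" where "p = monom 1 (Suc n) - monom 1 1 + 1"
  have "coeff p (Suc n) = 1"
    using assms by (simp add: p_def)
  then have "degree p > 0"
    by (metis le_degree less_le_trans zero_less_Suc zero_neq_one)
  then obtain a where a: "poly p a = 0"
    using alg_closed_imp_poly_has_root by blast
  then have "a * (a ^ n - 1) + 1 = 0"
    by (simp add: p_def poly_monom algebra_simps)
  then have "a \<noteq> 0" "a ^ n \<noteq> 1" by auto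
  then show thesis by (rule that)
qed

text \<open>The torus acts on a monomial by the character \<open>a ^ (xdeg - ydeg)\<close>, written with natural exponents.\<close>
lemma poly_subst_torus:
  assumes "a \<noteq> 0"
  shows "poly_subst (coord_image (torus_mat a)) p
    = (\<Sum>t\<in>keys p. single t (lookup p t * (a ^ xdeg t * inverse a ^ ydeg t)))"
proof -
  have "coord_image (torus_mat a) = (\<lambda>v. Const (case_var (\<lambda>_. a) (\<lambda>_. inverse a) v) * Var v)"
    by (rule ext) (case_tac v; simp add: torus_mat_def)
  then show ?thesis
    by (simp add: poly_subst_superset[of "keys p"] mono_eval_times mono_eval_Const mono_eval_Var mono_eval_torus)
qed

lemma poly_subst_swap:
  assumes "a \<noteq> 0"
  shows "poly_subst (coord_image (swap_mat a)) p
    = (\<Sum>t\<in>keys p. single (swap_mono t) (lookup p t * (a ^ xdeg t * inverse a ^ ydeg t)))"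
proof -
  have "coord_image (swap_mat a) = (\<lambda>v. Const (case_var (\<lambda>_. a) (\<lambda>_. inverse a) v) * Var (swap_var v))"
    by (rule ext) (case_tac v; simp add: swap_mat_def)
  then show ?thesis
    by (simp add: poly_subst_superset[of "keys p"] mono_eval_times mono_eval_Const mono_eval_Var_swap mono_eval_torus)
qed

lemma lookup_sum_single_inj:
  assumes "finite T" "inj f"
  shows "lookup (\<Sum>t\<in>T. single (f t) (c t)) (f s) = (if s \<in> T then c s else 0)"
  unfolding lookup_sum lookup_single using assms
  by (simp add: when_def inj_eq)

lemma inj_swap_mono: "inj swap_mono"
  by (metis injI swap_mono_swap_mono)

text \<open>The monomials are eigenvectors of the torus, so its invariants are spanned by monomials on which it
  acts trivially; on these every antidiagonal matrix acts as the swap.\<close>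
lemma invariants_iff:
  "(p :: 'k::alg_closed_field mpoly) \<in> invariants m \<longleftrightarrow>
     p \<in> poly_ring m \<and>
     (\<forall>t\<in>keys p. xdeg t = ydeg t) \<and>
     (\<forall>t. lookup p (swap_mono t) = lookup p t)"
  (is "_ \<longleftrightarrow> _ \<and> ?W \<and> ?S")
proof (intro iffI conjI ballI allI)
  assume p: "p \<in> invariants m"
  show "p \<in> poly_ring m" using p by (simp add: invariants_def)
  have eq: "lookup p t = lookup p t * (a ^ xdeg t * inverse a ^ ydeg t)" if "a \<noteq> 0" for a t
  proof -
    have "p = (\<Sum>t\<in>keys p. single t (lookup p t * (a ^ xdeg t * inverse a ^ ydeg t)))"
      using p torus_mat_in_O2[OF that] poly_subst_torus[OF that, of p] by (simp add: invariants_def)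
    from arg_cong[OF this, of "\<lambda>p. lookup p t"]
    have "lookup p t = (if t \<in> keys p
        then lookup p t * (a ^ xdeg t * inverse a ^ ydeg t) else 0)"
      by (subst (asm) lookup_sum_single_inj[where f = "\<lambda>t. t"]) simp_all
    then show ?thesis
      by (cases "t \<in> keys p") (simp_all add: in_keys_iff)
  qed
  show *: "xdeg t = ydeg t" if t: "t \<in> keys p" for t
  proof (rule ccontr)
    assume neq: "xdeg t \<noteq> ydeg t"
    have pow: "a ^ xdeg t = a ^ ydeg t" if "a \<noteq> 0" for a :: 'k
    proof -
      have "a ^ xdeg t * inverse a ^ ydeg t = 1"
        using eq[OF that, of t] t by (auto simp: in_keys_iff)
      then show ?thesis using that by (simp add: field_simps)
    qed
    define n where "n = (if xdeg t < ydeg t then ydeg t - xdeg t else xdeg t - ydeg t)"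
    have "n > 0" using neq by (auto simp: n_def)
    have "a ^ n = 1" if "a \<noteq> 0" for a :: 'k
    proof -
      have "a ^ max (xdeg t) (ydeg t) = a ^ min (xdeg t) (ydeg t)"
        using pow[OF that] by (auto simp: max_def min_def)
      moreover have "max (xdeg t) (ydeg t) = min (xdeg t) (ydeg t) + n"
        by (auto simp: n_def)
      ultimately show ?thesis using that by (simp add: power_add)
    qed
    then show False using alg_closed_power_neq_one[OF \<open>n > 0\<close>] by metis
  qed
  show "lookup p (swap_mono t) = lookup p t" for t
  proof -
    have "poly_subst (coord_image (swap_mat 1)) p = p"
      using p swap_mat_in_O2[of 1] by (auto simp: invariants_def)
    then have "p = (\<Sum>t\<in>keys p. single (swap_mono t) (lookup p t))"
      by (simp add: poly_subst_swap)
    from arg_cong[OF this, of "\<lambda>p. lookup p (swap_mono t)"] show ?thesis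
      by (subst (asm) lookup_sum_single_inj) (auto simp: inj_swap_mono in_keys_iff split: if_splits)
  qed
next
  assume *: "p \<in> poly_ring m \<and> ?W \<and> ?S"
  have one: "a ^ xdeg t * inverse a ^ ydeg t = 1" if "t \<in> keys p" "a \<noteq> 0" for a :: 'k and t
    using * that by (simp add: field_simps)
  have "poly_subst (coord_image A) p = p" if "A \<in> O2" for A
    using that
  proof (cases rule: O2_cases)
    case (1 a)
    have "poly_subst (coord_image A) p = (\<Sum>t\<in>keys p. single t (lookup p t))"
      unfolding 1(2) poly_subst_torus[OF 1(1)] by (intro sum.cong refl) (simp only: one[OF _ 1(1)] mult_1_right)
    then show ?thesis by (simp flip: poly_mapping_eq_sum_single)
  next
    case (2 a)
    have s: "poly_subst (coord_image A) p = (\<Sum>t\<in>keys p. single (swap_mono t) (lookup p t))"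
      unfolding 2(2) poly_subst_swap[OF 2(1)] by (intro sum.cong refl) (simp only: one[OF _ 2(1)] mult_1_right)
    show ?thesis
    proof (rule poly_mapping_eqI)
      fix t
      have "lookup (poly_subst (coord_image A) p) (swap_mono (swap_mono t)) = lookup p (swap_mono t)"
        unfolding s by (subst lookup_sum_single_inj) (auto simp: inj_swap_mono in_keys_iff)
      then show "lookup (poly_subst (coord_image A) p) t = lookup p t"
        using * by simp
    qed
  qed
  then show "p \<in> invariants m" using * by (simp add: invariants_def)
qed

section \<open>Subalgebras\<close>

lemma subalgebra_poly_ring: "subalgebra (poly_ring m)"
  unfolding subalgebra_def
proof (intro conjI ballI)
  show "range Const \<subseteq> poly_ring m"
    by (auto simp: poly_ring_def Const_def split: if_splits)
  fix p q :: "'k::comm_ring_1 mpoly" assume pq: "p \<in> poly_ring m" "q \<in> poly_ring m"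
  show "p + q \<in> poly_ring m"
    using pq keys_add[of p q] unfolding poly_ring_def by blast
  show "p * q \<in> poly_ring m"
    unfolding poly_ring_def
  proof (intro CollectI ballI)
    fix t v assume "t \<in> keys (p * q)" "v \<in> keys t"
    then obtain a b where "a \<in> keys p" "b \<in> keys q" "v \<in> keys (a + b)"
      using keys_mult[of p q] by blast
    then show "vec_index v \<in> {1..m}" using pq keys_add[of a b] unfolding poly_ring_def by blast
  qed
qed

lemma poly_subst_Const: "poly_subst \<sigma> (Const c) = Const c"
  by (subst (1) Const_def) simp

lemma subalgebra_invariants: "subalgebra (invariants m)"
  using subalgebra_poly_ring unfolding subalgebra_def invariants_def
  by (auto simp: poly_subst_add poly_subst_times poly_subst_Const)

lemma subalgebra_hull: "subalgebra (subalgebra hull G)"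
  by (rule hull_in) (fastforce simp: subalgebra_def)

lemma subalgebra_Const: "subalgebra S \<Longrightarrow> Const c \<in> S"
  by (auto simp: subalgebra_def)

lemma subalgebra_add: "subalgebra S \<Longrightarrow> p \<in> S \<Longrightarrow> q \<in> S \<Longrightarrow> p + q \<in> S"
  by (auto simp: subalgebra_def)

lemma subalgebra_times: "subalgebra S \<Longrightarrow> p \<in> S \<Longrightarrow> q \<in> S \<Longrightarrow> p * q \<in> S"
  by (auto simp: subalgebra_def)

lemma subalgebra_minus:
  assumes "subalgebra S" "p \<in> S" "q \<in> S" shows "p - q \<in> S"
proof -
  have "Const (-1) * q = - q" by (rule poly_mapping_eqI) simp
  then show ?thesis using subalgebra_add[OF assms(1,2) subalgebra_times[OF assms(1) subalgebra_Const[OF assms(1), of "-1"] assms(3)]]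
    by simp
qed

section \<open>Generation\<close>

definition ring_mono :: "nat \<Rightarrow> (var \<Rightarrow>\<^sub>0 nat) \<Rightarrow> bool" where
  "ring_mono m t \<longleftrightarrow> (\<forall>v\<in>keys t. vec_index v \<in> {1..m})"

lemma ring_mono_zero [simp]: "ring_mono m 0"
  by (simp add: ring_mono_def)

lemma ring_mono_add [simp]: "ring_mono m (s + t) \<longleftrightarrow> ring_mono m s \<and> ring_mono m t"
  by (auto simp: ring_mono_def in_keys_iff lookup_add)

lemma ring_mono_single [simp]: "ring_mono m (single v 1) \<longleftrightarrow> vec_index v \<in> {1..m}"
  by (simp add: ring_mono_def)

lemma ring_mono_swap [simp]: "ring_mono m (swap_mono t) \<longleftrightarrow> ring_mono m t"
  unfolding ring_mono_def Ball_def keys_swap_mono by (metis vec_index_swap_var swap_var_swap_var)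

definition orbit_sum :: "(var \<Rightarrow>\<^sub>0 nat) \<Rightarrow> 'k::comm_ring_1 mpoly" where
  "orbit_sum t = single t 1 + single (swap_mono t) 1"

abbreviation X :: "nat \<Rightarrow> var \<Rightarrow>\<^sub>0 nat" where "X i \<equiv> single (VX i) 1"
abbreviation Y :: "nat \<Rightarrow> var \<Rightarrow>\<^sub>0 nat" where "Y i \<equiv> single (VY i) 1"

lemma orbit_sum_swap: "orbit_sum (swap_mono t) = orbit_sum t"
  by (simp add: orbit_sum_def add.commute)

lemma Q_inv_eq: "Q_inv i = single (X i + Y i) 1"
  by (simp add: Q_inv_def Var_def mult_single)

lemma orbit_sum_Q: "orbit_sum (X i + Y i + t) = Q_inv i * orbit_sum t"
  by (simp add: orbit_sum_def Q_inv_eq mult_single distrib_left swap_mono_add add.commute)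

text \<open>This relation is the engine of the generation proof: of the four terms of the product, two
  form the orbit of \<open>x\<^sub>i y\<^sub>j t\<close>, and the other two that of \<open>x\<^sub>j y\<^sub>i t\<close>.\<close>
lemma orbit_sum_exchange:
  "orbit_sum (X i + Y j) * orbit_sum t = orbit_sum (X i + Y j + t) + orbit_sum (X j + Y i + t)"
  by (simp add: orbit_sum_def mult_single distrib_left distrib_right swap_mono_add add_ac)

lemma prod_list_Var:
  assumes "distinct vs"
  shows "(\<Prod>v\<leftarrow>vs. Var (f v)) = single (\<Sum>v\<in>set vs. single (f v) 1) 1"
  using assms by (induction vs) (auto simp: Var_def mult_single)

lemma swap_mono_sum: "swap_mono (\<Sum>i\<in>I. f i) = (\<Sum>i\<in>I. swap_mono (f i))"
  by (induction I rule: infinite_finite_induct) (auto simp: swap_mono_add)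

lemma B_inv_eq_orbit_sum:
  assumes "distinct il" "distinct jl"
  shows "B_inv il jl = orbit_sum ((\<Sum>i\<in>set il. X i) + (\<Sum>j\<in>set jl. Y j))"
  using assms
  by (simp add: B_inv_def orbit_sum_def prod_list_Var swap_mono_sum swap_mono_add mult_single)

lemma in_keys_single_add [simp]:
  fixes t :: "var \<Rightarrow>\<^sub>0 nat"
  shows "v \<in> keys (single u 1 + t) \<longleftrightarrow> v = u \<or> v \<in> keys t"
  by (auto simp: in_keys_iff lookup_add lookup_single when_def)

lemma xdeg_pos_iff: "xdeg t > 0 \<longleftrightarrow> (\<exists>i. VX i \<in> keys t)"
proof
  assume "\<exists>i. VX i \<in> keys t"
  then obtain i t' where "t = X i + t'" by (metis mono_split)
  then show "xdeg t > 0" by simp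
next
  assume "xdeg t > 0"
  then obtain v where "v \<in> keys t" "(case v of VX _ \<Rightarrow> 1 | VY _ \<Rightarrow> 0) \<noteq> (0::nat)"
    unfolding xdeg_def weight_def by (metis (no_types, lifting) less_irrefl mult_0_right sum.neutral)
  then show "\<exists>i. VX i \<in> keys t" by (cases v) auto
qed

lemma ydeg_pos_iff: "ydeg t > 0 \<longleftrightarrow> (\<exists>j. VY j \<in> keys t)"
  using xdeg_pos_iff[of "swap_mono t"] by (simp add: keys_swap_mono)

lemma mono_eq_zeroI:
  assumes "xdeg t = 0" "ydeg t = 0" shows "t = 0"
proof -
  have "v \<notin> keys t" for v
    using assms xdeg_pos_iff[of t] ydeg_pos_iff[of t] by (cases v) auto
  then show ?thesis by (metis all_not_in_conv keys_eq_empty)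
qed

text \<open>In a monomial fixed by the swap, \<open>x\<^sub>i\<close> and \<open>y\<^sub>i\<close> have equal exponents, so it is a product of
  \<open>Q\<close>'s.\<close>
lemma single_fixed_in_subalgebra:
  fixes S :: "'k::comm_ring_1 mpoly set"
  assumes "subalgebra S" and "\<And>i. i \<in> {1..m} \<Longrightarrow> Q_inv i \<in> S"
    and "swap_mono t = t" and "ring_mono m t"
  shows "single t 1 \<in> S"
  using assms(3,4)
proof (induction "xdeg t" arbitrary: t rule: less_induct)
  case less
  show ?case
  proof (cases "xdeg t = 0")
    case True
    then have "ydeg t = 0" using less.prems(1) xdeg_swap_mono[of t] by simp
    then have "t = 0" using True by (intro mono_eq_zeroI)
    then have "single t (1::'k) = Const 1" by (simp add: Const_def)
    then show ?thesis using subalgebra_Const[OF assms(1), of 1] by simp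
  next
    case False
    then obtain i where i: "VX i \<in> keys t" using xdeg_pos_iff[of t] by auto
    then obtain u where u: "t = X i + u" by (rule mono_split)
    have "VY i \<in> keys t" using i less.prems(1) keys_swap_mono[of "VY i" t] by simp
    then have "VY i \<in> keys u" using u by auto
    then obtain s where s: "u = Y i + s" by (rule mono_split)
    have "single s 1 \<in> S"
    proof (rule less.hyps)
      show "xdeg s < xdeg t" by (simp add: u s)
      show "swap_mono s = s" using less.prems(1) by (simp add: u s swap_mono_add add_ac)
      show "ring_mono m s" using less.prems(2) by (simp add: u s)
    qed
    moreover have "Q_inv i \<in> S" using less.prems(2) by (intro assms(2)) (simp add: u)
    moreover have "single t (1::'k) = Q_inv i * single s 1"
      by (simp add: Q_inv_eq mult_single u s add_ac)
    ultimately show ?thesis using assms(1) by (simp add: subalgebra_times)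
  qed
qed

lemma lookup_sum_X [simp]:
  "finite I \<Longrightarrow> lookup (\<Sum>i\<in>I. X i) v = (case v of VX i \<Rightarrow> of_bool (i \<in> I) | VY _ \<Rightarrow> 0)"
  by (cases v) (simp_all add: lookup_sum lookup_single when_def)

lemma lookup_sum_Y [simp]:
  "finite I \<Longrightarrow> lookup (\<Sum>i\<in>I. Y i) v = (case v of VY i \<Rightarrow> of_bool (i \<in> I) | VX _ \<Rightarrow> 0)"
  by (cases v) (simp_all add: lookup_sum lookup_single when_def)

lemma xdeg_sum: "xdeg (\<Sum>i\<in>I. f i) = (\<Sum>i\<in>I. xdeg (f i))"
  and ydeg_sum: "ydeg (\<Sum>i\<in>I. f i) = (\<Sum>i\<in>I. ydeg (f i))"
  by (induction I rule: infinite_finite_induct) auto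

text \<open>The outer induction is on the degree. Among the balanced monomials of a given degree, exchanging the
  indices of \<open>x\<^sub>i\<close> and \<open>y\<^sub>j\<close> with \<open>j < i\<close> lowers the sum of all \<open>x\<close>-indices, which is the
  measure of an inner induction. It stops at a monomial in which some index repeats, or
  at one whose \<open>x\<close>-indices all precede its \<open>y\<close>-indices.\<close>
lemma orbit_sum_in_subalgebra:
  fixes S :: "'k::comm_ring_1 mpoly set"
  assumes S: "subalgebra S" and gens: "gens m \<subseteq> S"
    and "xdeg t = ydeg t" and "ring_mono m t"
  shows "orbit_sum t \<in> S"
  using assms(3,4)
proof (induction "xdeg t" arbitrary: t rule: less_induct)
  case less
  note outer = less.hyps
  have Q: "Q_inv i \<in> S" if "i \<in> {1..m}" for i
    using that gens by (auto simp: gens_def)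
  (* The monomials that the exchanges can reach stay in the degree of t. *)
  define admissible where "admissible s \<longleftrightarrow> xdeg s = xdeg t \<and> ydeg s = xdeg t \<and> ring_mono m s" for s
  have factor: "orbit_sum s \<in> S" if adm: "admissible s" and x: "VX i \<in> keys s" and y: "VY i \<in> keys s" for s i
  proof -
    obtain u where u: "s = X i + u" using x by (rule mono_split)
    then have "VY i \<in> keys u" using y by auto
    then obtain v where v: "u = Y i + v" by (rule mono_split)
    have "orbit_sum v \<in> S"
      using adm by (intro outer) (auto simp: admissible_def u v)
    moreover have "i \<in> {1..m}" using adm by (auto simp: admissible_def u)
    ultimately show ?thesis
      using subalgebra_times[OF S Q[of i]] by (simp add: u v orbit_sum_Q flip: add.assoc)
  qed
  have exchange: "orbit_sum (X i + (Y j + s)) \<in> S"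
    if adm: "admissible (X i + (Y j + s))" and o: "orbit_sum (X j + (Y i + s)) \<in> S" for i j s
  proof (cases "s = 0")
    case True
    (* Here there is no smaller orbit sum to multiply with, but the exchange is the swap itself. *)
    have "(orbit_sum (X i + Y j) :: 'k mpoly) = orbit_sum (swap_mono (X j + Y i))"
      by (simp add: swap_mono_add add.commute)
    then show ?thesis using o True by (simp add: orbit_sum_swap)
  next
    case False
    have "orbit_sum s \<in> S"
      using adm by (intro outer) (auto simp: admissible_def)
    moreover have "xdeg s = ydeg s"
      using adm by (simp add: admissible_def)
    then have "xdeg s \<noteq> 0"
      using False mono_eq_zeroI[of s] by metis
    then have "orbit_sum (X i + Y j) \<in> S"
      using adm by (intro outer) (auto simp: admissible_def)
    ultimately have "orbit_sum (X i + Y j) * orbit_sum s - orbit_sum (X j + (Y i + s)) \<in> S"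
      using o by (intro subalgebra_minus subalgebra_times S)
    then show ?thesis by (simp add: orbit_sum_exchange add.assoc)
  qed
  (* Exchanging one of the two factors x_i with some y_j produces a monomial divisible by x_i y_i. *)
  have repeated: "orbit_sum s \<in> S" if adm: "admissible s" and "lookup s (VX i) \<ge> 2" for s i
  proof -
    have "VX i \<in> keys s" using that by (simp add: in_keys_iff)
    then obtain u where u: "s = X i + u" by (rule mono_split)
    have iu: "VX i \<in> keys u" using that by (simp add: u lookup_add in_keys_iff)
    have "ydeg s > 0" using adm by (auto simp: admissible_def u)
    then obtain j where "VY j \<in> keys u" by (auto simp: ydeg_pos_iff u)
    then obtain v where v: "u = Y j + v" by (rule mono_split)
    have iv: "VX i \<in> keys v" using iu v by auto
    have "orbit_sum (X j + (Y i + v)) \<in> S"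
    proof (rule factor[of _ i])
      show "admissible (X j + (Y i + v))" using adm by (auto simp: admissible_def u v)
    qed (use iv in auto)
    then show ?thesis using adm unfolding u v by (metis exchange)
  qed
  have repeated_any: "orbit_sum s \<in> S" if adm: "admissible s" and "lookup s v \<ge> 2" for s v
  proof (cases v)
    case (VX i)
    then show ?thesis using repeated that by blast
  next
    case (VY i)
    have "admissible (swap_mono s)" using adm by (simp add: admissible_def)
    then have "orbit_sum (swap_mono s) \<in> S" by (rule repeated[of _ i]) (use VY that in simp)
    then show ?thesis by (simp add: orbit_sum_swap)
  qed
  define xsum where "xsum = weight (case_var (\<lambda>i. i) (\<lambda>_. 0))"
  have "orbit_sum s \<in> S" if "admissible s" for s
    using that
  proof (induction "xsum s" arbitrary: s rule: less_induct)
    case (less s)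
    consider (repeated) v where "lookup s v \<ge> 2"
      | (inversion) i j where "VX i \<in> keys s" "VY j \<in> keys s" "j \<le> i"
      | (sorted) "\<And>v. lookup s v < 2"
        "\<And>i j. VX i \<in> keys s \<Longrightarrow> VY j \<in> keys s \<Longrightarrow> i < j"
      by (meson not_le)
    then show ?case
    proof cases
      case repeated
      then show ?thesis using repeated_any less.prems by blast
    next
      case inversion
      show ?thesis
      proof (cases "i = j")
        case True
        then show ?thesis using factor inversion less.prems by blast
      next
        case False
        obtain u where u: "s = X i + u" using inversion(1) by (rule mono_split)
        have "VY j \<in> keys u" using inversion(2) by (auto simp: u)
        then obtain v where v: "u = Y j + v" by (rule mono_split)
        have "orbit_sum (X j + (Y i + v)) \<in> S"
        proof (rule less.hyps)
          show "xsum (X j + (Y i + v)) < xsum s"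
            using False inversion(3) by (simp add: xsum_def u v weight_add)
          show "admissible (X j + (Y i + v))" using less.prems by (auto simp: admissible_def u v)
        qed
        then show ?thesis using less.prems unfolding u v by (metis exchange)
      qed
    next
      case sorted
      define I where "I = {i. VX i \<in> keys s}"
      define J where "J = {j. VY j \<in> keys s}"
      have fin: "finite I" "finite J"
        unfolding I_def J_def by (auto intro!: finite_vimageI[unfolded vimage_def] injI)
      have s: "s = (\<Sum>i\<in>I. X i) + (\<Sum>j\<in>J. Y j)"
      proof (rule poly_mapping_eqI)
        fix v
        show "lookup s v = lookup ((\<Sum>i\<in>I. X i) + (\<Sum>j\<in>J. Y j)) v"
          using sorted(1)[of v] fin by (cases v) (auto simp: lookup_add I_def J_def in_keys_iff)
      qed
      show ?thesis
      proof (cases "I = {}")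
        case True
        have "s = 0"
          using less.prems xdeg_pos_iff[of s] True by (intro mono_eq_zeroI) (auto simp: admissible_def I_def)
        then have "orbit_sum s = Const (1::'k) + Const 1" by (simp add: orbit_sum_def)
        then show ?thesis using S by (simp only: subalgebra_add subalgebra_Const)
      next
        case False
        have c: "card I = card J"
          using less.prems by (simp add: admissible_def s xdeg_sum ydeg_sum)
        have IJ: "i < j" if "i \<in> I" "j \<in> J" for i j
          using sorted(2) that by (simp add: I_def J_def)
        let ?il = "sorted_list_of_set I" and ?jl = "sorted_list_of_set J"
        have "sorted_wrt (<) (?il @ ?jl)"
          using fin IJ by (simp add: sorted_wrt_append)
        moreover have "set (?il @ ?jl) \<subseteq> {1..m}"
          using less.prems fin by (auto simp: admissible_def ring_mono_def I_def J_def)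
        moreover have "length ?il = length ?jl" "length ?il \<ge> 1"
          using c False fin card_gt_0_iff[of I] by (simp_all add: less_eq_Suc_le One_nat_def)
        ultimately have "B_inv ?il ?jl \<in> S"
          using gens unfolding gens_def by blast
        then show ?thesis
          using fin by (simp add: s B_inv_eq_orbit_sum)
      qed
    qed
  qed
  then show ?case using less.prems by (auto simp: admissible_def)
qed

lemma orbit_sum_in_invariants:
  assumes "xdeg t = ydeg t" "ring_mono m t"
  shows "(orbit_sum t :: 'k::alg_closed_field mpoly) \<in> invariants m"
  unfolding invariants_iff
proof (intro conjI ballI allI)
  have k: "keys (orbit_sum t :: 'k mpoly) \<subseteq> {t, swap_mono t}"
    unfolding orbit_sum_def using keys_add[of "single t (1::'k)" "single (swap_mono t) 1"] by auto
  show "(orbit_sum t :: 'k mpoly) \<in> poly_ring m"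
    using k assms(2) ring_mono_swap[of m t] unfolding poly_ring_def ring_mono_def by blast
  show "xdeg s = ydeg s" if "s \<in> keys (orbit_sum t :: 'k mpoly)" for s
    using that k assms(1) by auto
  show "lookup (orbit_sum t :: 'k mpoly) (swap_mono s) = lookup (orbit_sum t) s" for s
  proof -
    have "t = swap_mono s \<longleftrightarrow> swap_mono t = s" "swap_mono t = swap_mono s \<longleftrightarrow> t = s"
      by auto (metis swap_mono_swap_mono)
    then show ?thesis by (simp add: orbit_sum_def lookup_add lookup_single when_def)
  qed
qed

lemma Q_inv_in_invariants:
  assumes "i \<in> {1..m}"
  shows "(Q_inv i :: 'k::alg_closed_field mpoly) \<in> invariants m"
proof -
  have "X i + Y i = swap_mono t \<longleftrightarrow> X i + Y i = t" for t
    by (metis swap_mono_swap_mono swap_mono_add swap_mono_single swap_var.simps add.commute)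
  then show ?thesis
    using assms by (auto simp: invariants_iff Q_inv_eq poly_ring_def lookup_single when_def)
qed

text \<open>An invariant is reduced to \<open>0\<close> by subtracting, one swap orbit at a time, multiples of fixed monomials and
  of orbit sums.\<close>
lemma generates_gens: "generates (gens m) (invariants m :: 'k::alg_closed_field mpoly set)"
  unfolding generates_def
proof (rule subset_antisym)
  show "subalgebra hull gens m \<subseteq> (invariants m :: 'k mpoly set)"
  proof (rule hull_minimal)
    show "subalgebra (invariants m :: 'k mpoly set)" by (rule subalgebra_invariants)
    show "gens m \<subseteq> (invariants m :: 'k mpoly set)"
    proof
      fix g :: "'k mpoly" assume "g \<in> gens m"
      then consider i where "g = Q_inv i" "i \<in> {1..m}"
        | il jl where "g = B_inv il jl" "length il = length jl" "sorted_wrt (<) (il @ jl)" "set (il @ jl) \<subseteq> {1..m}"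
        by (auto simp: gens_def)
      then show "g \<in> invariants m"
      proof cases
        case 1
        then show ?thesis by (simp add: Q_inv_in_invariants)
      next
        case (2 il jl)
        then have d: "distinct il" "distinct jl"
          by (simp_all add: sorted_wrt_append strict_sorted_iff)
        then have "card (set il) = card (set jl)" using 2(2) by (simp add: distinct_card)
        moreover have "ring_mono m (\<Sum>i\<in>set il. X i)" "ring_mono m (\<Sum>j\<in>set jl. Y j)"
          using 2(4) by (auto simp: ring_mono_def in_keys_iff subset_iff split: var.splits)
        ultimately show ?thesis
          unfolding 2(1) B_inv_eq_orbit_sum[OF d]
          by (intro orbit_sum_in_invariants) (simp_all add: xdeg_sum ydeg_sum)
      qed
    qed
  qed
next
  let ?S = "subalgebra hull gens m :: 'k mpoly set"
  have gens: "gens m \<subseteq> ?S" by (rule hull_subset)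
  have Q: "Q_inv i \<in> ?S" if "i \<in> {1..m}" for i
    using that gens by (auto simp: gens_def)
  show "invariants m \<subseteq> ?S"
  proof
    fix p :: "'k mpoly" assume "p \<in> invariants m"
    then show "p \<in> ?S"
    proof (induction "card (keys p)" arbitrary: p rule: less_induct)
      case less
      have p: "\<And>t. t \<in> keys p \<Longrightarrow> xdeg t = ydeg t" "\<And>t. t \<in> keys p \<Longrightarrow> ring_mono m t"
        "\<And>t. lookup p (swap_mono t) = lookup p t"
        using less.prems by (auto simp: invariants_iff poly_ring_def ring_mono_def)
      show ?case
      proof (cases "p = 0")
        case True
        then show ?thesis using subalgebra_Const[OF subalgebra_hull, of 0 "gens m"] by simp
      next
        case False
        then obtain t where t: "t \<in> keys p" by (metis all_not_in_conv keys_eq_empty)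
        define c where "c = lookup p t"
        define f :: "'k mpoly" where "f = (if swap_mono t = t then single t 1 else orbit_sum t)"
        have f: "lookup f s = of_bool (s \<in> {t, swap_mono t})" for s
          by (auto simp: f_def orbit_sum_def lookup_add lookup_single when_def)
        have "f \<in> ?S"
          unfolding f_def using single_fixed_in_subalgebra[OF subalgebra_hull Q] orbit_sum_in_subalgebra[OF subalgebra_hull gens] p(1,2)[OF t] by auto
        then have cf: "Const c * f \<in> ?S" by (intro subalgebra_times subalgebra_Const subalgebra_hull)
        define q where "q = p - Const c * f"
        have q: "lookup q s = (if s \<in> {t, swap_mono t} then 0 else lookup p s)" for s
          using p(3)[of t] by (auto simp: q_def lookup_minus f c_def)
        have kq: "keys q \<subseteq> keys p - {t}"
          by (auto simp: in_keys_iff q split: if_splits)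
        have "q \<in> ?S"
        proof (rule less.hyps)
          show "card (keys q) < card (keys p)"
            using kq t by (intro psubset_card_mono) auto
          show "q \<in> invariants m"
            unfolding invariants_iff
          proof (intro conjI ballI allI)
            show "q \<in> poly_ring m" using kq p(2) by (auto simp: poly_ring_def ring_mono_def)
            show "xdeg s = ydeg s" if "s \<in> keys q" for s using kq p(1) that by blast
            show "lookup q (swap_mono s) = lookup q s" for s
              unfolding q p(3) by (auto) (metis swap_mono_swap_mono)+
          qed
        qed
        then have "q + Const c * f \<in> ?S" by (intro subalgebra_add subalgebra_hull cf)
        then show ?thesis by (simp add: q_def)
      qed
    qed
  qed
qed

section \<open>Functionals that vanish on decomposable invariants\<close>

definition coeff_sum :: "(var \<Rightarrow>\<^sub>0 nat) set \<Rightarrow> 'k::comm_ring_1 mpoly \<Rightarrow> 'k" where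
  "coeff_sum M p = (\<Sum>t\<in>keys p. lookup p t * of_bool (t \<in> M))"

lemma coeff_sum_superset:
  assumes "finite T" "keys p \<subseteq> T"
  shows "coeff_sum M p = (\<Sum>t\<in>T. lookup p t * of_bool (t \<in> M))"
  unfolding coeff_sum_def using assms
  by (intro sum.mono_neutral_left) (auto simp: in_keys_iff)

lemma coeff_sum_zero [simp]: "coeff_sum M 0 = 0"
  by (simp add: coeff_sum_def)

lemma coeff_sum_single [simp]: "coeff_sum M (single t c) = c * of_bool (t \<in> M)"
  by (subst coeff_sum_superset[of "{t}"]) auto

lemma coeff_sum_add: "coeff_sum M (p + q) = coeff_sum M p + coeff_sum M q"
proof -
  let ?T = "keys p \<union> keys q"
  have "coeff_sum M (p + q) = (\<Sum>t\<in>?T. lookup (p + q) t * of_bool (t \<in> M))"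
    by (rule coeff_sum_superset) (simp_all add: keys_add)
  then show ?thesis
    by (simp add: lookup_add distrib_right sum.distrib coeff_sum_superset[of ?T])
qed

lemma coeff_sum_sum: "coeff_sum M (\<Sum>i\<in>I. f i) = (\<Sum>i\<in>I. coeff_sum M (f i))"
  by (induction I rule: infinite_finite_induct) (auto simp: coeff_sum_add)

lemma coeff_sum_times:
  "coeff_sum M (p * q) = (\<Sum>s\<in>keys p. \<Sum>t\<in>keys q.
     lookup p s * lookup q t * of_bool (s + t \<in> M))"
  by (subst times_eq_sum_single) (simp add: coeff_sum_sum)

text \<open>The functional kills the constants because \<open>0 \<notin> M\<close>; by the derivation rule its kernel is a
  subalgebra, which therefore cannot contain a generating set unless it is everything.\<close>
lemma exists_generator_detected:
  fixes M :: "(var \<Rightarrow>\<^sub>0 nat) set" and S :: "'k::comm_ring_1 mpoly set"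
  assumes gen: "generates G S" and "0 \<notin> M"
    and der: "\<And>p q. p \<in> S \<Longrightarrow> q \<in> S \<Longrightarrow>
      coeff_sum M (p * q) = coeff_sum M p * lookup q 0 + lookup p 0 * coeff_sum M q"
    and f: "f \<in> S" "coeff_sum M f \<noteq> 0"
  shows "\<exists>g\<in>G. g \<in> S \<and> (\<exists>t\<in>keys g. t \<in> M)"
proof (rule ccontr)
  assume none: "\<not> ?thesis"
  have S: "subalgebra S" "G \<subseteq> S"
    using gen subalgebra_hull[of G] hull_subset[of G subalgebra] by (auto simp: generates_def)
  have "S \<subseteq> {p \<in> S. coeff_sum M p = 0}"
  proof -
    have "subalgebra hull G \<subseteq> {p \<in> S. coeff_sum M p = 0}"
    proof (rule hull_minimal)
      show "G \<subseteq> {p \<in> S. coeff_sum M p = 0}"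
        using none S(2) by (auto simp: coeff_sum_def intro!: sum.neutral)
      show "subalgebra {p \<in> S. coeff_sum M p = 0}"
        using S(1) der \<open>0 \<notin> M\<close> by (auto simp: subalgebra_def coeff_sum_add) (simp add: Const_def)
    qed
    then show ?thesis using gen by (simp add: generates_def)
  qed
  then show False using f by blast
qed

lemma sum_cancel_involution:
  fixes f :: "'a \<Rightarrow> 'b::comm_ring_1"
  assumes "(2::'b) = 0" "finite T"
    and "\<And>t. t \<in> T \<Longrightarrow> \<tau> t \<in> T \<and> \<tau> t \<noteq> t \<and> \<tau> (\<tau> t) = t \<and> f (\<tau> t) = f t"
  shows "sum f T = 0"
  using assms(2,3)
proof (induction "card T" arbitrary: T rule: less_induct)
  case less
  show ?case
  proof (cases "T = {}")
    case False
    then obtain t where t: "t \<in> T" by blast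
    have "sum f T = f t + (f (\<tau> t) + sum f (T - {t} - {\<tau> t}))"
      using less.prems(1) less.prems(2)[OF t] t sum.remove[of T t f] sum.remove[of "T - {t}" "\<tau> t" f] by simp
    moreover have "sum f (T - {t} - {\<tau> t}) = 0"
    proof (rule less.hyps)
      show "card (T - {t} - {\<tau> t}) < card T"
        using less.prems(1) t by (intro psubset_card_mono) auto
      show "\<tau> s \<in> T - {t} - {\<tau> t} \<and> \<tau> s \<noteq> s \<and> \<tau> (\<tau> s) = s \<and> f (\<tau> s) = f s" if "s \<in> T - {t} - {\<tau> t}" for s
        using that less.prems(2)[of s] less.prems(2)[OF t] by auto
    qed (use less.prems in auto)
    ultimately show ?thesis using less.prems(2)[OF t] assms(1) by (simp flip: mult_2)
  qed simp
qed

text \<open>Balanced monomials have even degree, so \<open>x\<^sub>i y\<^sub>i\<close> is a product of two of them only in the trivial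
  ways.\<close>
lemma coeff_sum_Q_inv_derivation:
  fixes p q :: "'k::comm_ring_1 mpoly"
  assumes "\<And>t. t \<in> keys p \<Longrightarrow> xdeg t = ydeg t" "\<And>t. t \<in> keys q \<Longrightarrow> xdeg t = ydeg t"
  shows "coeff_sum {X i + Y i} (p * q) =
    coeff_sum {X i + Y i} p * lookup q 0 + lookup p 0 * coeff_sum {X i + Y i} q"
proof -
  let ?M = "{X i + Y i}"
  have 0: "X i + Y i \<noteq> 0" by (metis add_is_0 xdeg_add xdeg_single_VX xdeg_zero zero_neq_one)
  have split: "of_bool (s + t \<in> ?M) = of_bool (s \<in> ?M) * of_bool (t = 0) + of_bool (s = 0) * (of_bool (t \<in> ?M) :: 'k)"
    if "s \<in> keys p" "t \<in> keys q" for s t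
  proof -
    have "s = 0 \<or> t = 0" if "s + t = X i + Y i"
    proof -
      have "xdeg s + xdeg t = 1" "ydeg s + ydeg t = 1"
        using arg_cong[OF that, of xdeg] arg_cong[OF that, of ydeg] by simp_all
      then have "xdeg s = 0 \<and> ydeg s = 0 \<or> xdeg t = 0 \<and> ydeg t = 0"
        using assms(1)[OF \<open>s \<in> _\<close>] assms(2)[OF \<open>t \<in> _\<close>] by linarith
      then show ?thesis using mono_eq_zeroI by blast
    qed
    then show ?thesis using 0 by auto
  qed
  have l: "lookup r 0 = (\<Sum>t\<in>keys r. lookup r t * of_bool (t = 0))" for r :: "'k mpoly"
    by (simp add: of_bool_def in_keys_iff if_distrib cong: if_cong)
  have "coeff_sum ?M (p * q) = (\<Sum>s\<in>keys p. \<Sum>t\<in>keys q.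
     lookup p s * lookup q t * (of_bool (s \<in> ?M) * of_bool (t = 0) + of_bool (s = 0) * of_bool (t \<in> ?M)))"
    unfolding coeff_sum_times by (intro sum.cong refl) (simp only: split)
  also have "\<dots> = (\<Sum>s\<in>keys p. \<Sum>t\<in>keys q.
        (lookup p s * of_bool (s \<in> ?M)) * (lookup q t * of_bool (t = 0)))
      + (\<Sum>s\<in>keys p. \<Sum>t\<in>keys q.
        (lookup p s * of_bool (s = 0)) * (lookup q t * of_bool (t \<in> ?M)))"
    by (simp only: distrib_left sum.distrib mult_ac)
  also have "\<dots> = coeff_sum ?M p * lookup q 0 + lookup p 0 * coeff_sum ?M q"
    unfolding l coeff_sum_def by (simp only: sum_product)
  finally show ?thesis .
qed

text \<open>These are the monomials \<open>x\<^sub>I y\<^sub>J\<close> with \<open>J = D - I\<close> and \<open>d \<in> I\<close>. If \<open>d \<in> D\<close>, this condition selects one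
  monomial from each swap orbit; without it the coefficients of a swap-invariant polynomial would add up
  to \<open>0\<close> in characteristic \<open>2\<close>, for every non-empty \<open>D\<close>.\<close>
definition squarefree_monos :: "nat set \<Rightarrow> nat \<Rightarrow> (var \<Rightarrow>\<^sub>0 nat) set" where
  "squarefree_monos D d = {t. (\<forall>i. mono_multideg t i = of_bool (i \<in> D)) \<and> lookup t (VX d) = 1}"

lemma mono_multideg_add [simp]: "mono_multideg (s + t) i = mono_multideg s i + mono_multideg t i"
  by (simp add: mono_multideg_def lookup_add)

lemma mono_multideg_swap [simp]: "mono_multideg (swap_mono t) i = mono_multideg t i"
  by (simp add: mono_multideg_def)

lemma mono_multideg_zero [simp]: "mono_multideg 0 i = 0"
  by (simp add: mono_multideg_def)

lemma mono_eq_zero_iff_multideg: "t = 0 \<longleftrightarrow> (\<forall>i. mono_multideg t i = 0)"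
proof
  assume *: "\<forall>i. mono_multideg t i = 0"
  have "lookup t v = 0" for v
    using * by (cases v) (auto simp: mono_multideg_def)
  then show "t = 0" by (intro poly_mapping_eqI) simp
qed simp

text \<open>Once \<open>s\<close> contains \<open>x\<^sub>d\<close>, the cofactors \<open>t\<close> are the squarefree monomials on the
  remaining indices, and the swap permutes them with \<open>t = 1\<close> as its only fixed point. The other terms
  cancel in pairs.\<close>
lemma sum_cofactors_containing_VX:
  fixes q :: "'k::comm_ring_1 mpoly"
  assumes two: "(2::'k) = 0"
    and sym: "\<And>t. lookup q (swap_mono t) = lookup q t"
    and s: "lookup s (VX d) = 1"
  shows "(\<Sum>t\<in>keys q. lookup q t * of_bool (s + t \<in> squarefree_monos D d))
      = of_bool (s \<in> squarefree_monos D d) * lookup q 0"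
proof -
  let ?M = "squarefree_monos D d"
  define T where "T = {t \<in> keys q. s + t \<in> ?M}"
  have le: "mono_multideg t i \<le> 1" "mono_multideg s d + mono_multideg t d \<le> 1" if "t \<in> T" for t i
    using that by (auto simp: T_def squarefree_monos_def of_bool_def split: if_splits) (metis add_leD2 le_refl zero_le)+
  have dzero: "lookup t (VX d) = 0" "lookup t (VY d) = 0" if "t \<in> T" for t
    using le(2)[OF that] s by (auto simp: mono_multideg_def)
  have swap: "swap_mono t \<in> T" if "t \<in> T" for t
    using that dzero[OF that] sym[of t]
    by (auto simp: T_def squarefree_monos_def in_keys_iff lookup_add)
  have moved: "swap_mono t \<noteq> t" if "t \<in> T" "t \<noteq> 0" for t
  proof
    assume "swap_mono t = t"
    then have "lookup t (VX i) = lookup t (VY i)" for i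
      by (metis lookup_swap_mono swap_var.simps(1))
    then have "mono_multideg t i = 0" for i
      using le(1)[OF that(1), of i] by (simp add: mono_multideg_def)
    then show False using that(2) by (simp add: mono_eq_zero_iff_multideg)
  qed
  have "(\<Sum>t\<in>keys q. lookup q t * of_bool (s + t \<in> ?M)) = (\<Sum>t\<in>T. lookup q t)"
    by (simp add: T_def of_bool_def if_distrib sum.If_cases Int_def cong: if_cong)
  also have "\<dots> = (\<Sum>t\<in>T \<inter> {0}. lookup q t) + (\<Sum>t\<in>T - {0}. lookup q t)"
    by (rule sum.Int_Diff) (simp add: T_def)
  also have "(\<Sum>t\<in>T - {0}. lookup q t) = 0"
  proof (rule sum_cancel_involution[OF two, of _ swap_mono])
    show "swap_mono t \<in> T - {0} \<and> swap_mono t \<noteq> t \<and> swap_mono (swap_mono t) = t \<and>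
        lookup q (swap_mono t) = lookup q t" if "t \<in> T - {0}" for t
      using that swap moved sym by auto (metis swap_mono_swap_mono swap_mono_zero)
  qed (simp add: T_def)
  also have "(\<Sum>t\<in>T \<inter> {0}. lookup q t) = of_bool (s \<in> ?M) * lookup q 0"
  proof -
    have "0 \<in> T \<longleftrightarrow> s \<in> ?M \<and> lookup q 0 \<noteq> 0" by (auto simp: T_def in_keys_iff)
    then show ?thesis by (cases "0 \<in> T") auto
  qed
  finally show ?thesis by simp
qed

text \<open>In a factorisation of a monomial in \<open>squarefree_monos D d\<close> exactly one factor contains \<open>x\<^sub>d\<close>. This splits the
  sum over all factorisations into two halves, to each of which the preceding lemma applies.\<close>
lemma coeff_sum_squarefree_derivation:
  fixes p q :: "'k::comm_ring_1 mpoly"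
  assumes two: "(2::'k) = 0"
    and p: "\<And>t. lookup p (swap_mono t) = lookup p t"
    and q: "\<And>t. lookup q (swap_mono t) = lookup q t"
  shows "coeff_sum (squarefree_monos D d) (p * q) =
    coeff_sum (squarefree_monos D d) p * lookup q 0 + lookup p 0 * coeff_sum (squarefree_monos D d) q"
proof -
  let ?M = "squarefree_monos D d"
  let ?x = "\<lambda>t. of_bool (lookup t (VX d) = 1) :: 'k"
  have split: "of_bool (s + t \<in> ?M) = ?x s * of_bool (s + t \<in> ?M) + ?x t * of_bool (t + s \<in> ?M)" for s t
    by (auto simp: squarefree_monos_def lookup_add add_is_1 add.commute[of t s])
  have half: "?x s * (\<Sum>t\<in>keys r. lookup r t * of_bool (s + t \<in> ?M))
      = of_bool (s \<in> ?M) * lookup r 0"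
    if "\<And>t. lookup r (swap_mono t) = lookup r t" for s and r :: "'k mpoly"
  proof (cases "lookup s (VX d) = 1")
    case True
    then show ?thesis using sum_cofactors_containing_VX[OF two that True, of D] by simp
  qed (simp add: squarefree_monos_def)
  have "coeff_sum ?M (p * q) =
      (\<Sum>s\<in>keys p. \<Sum>t\<in>keys q. lookup p s * lookup q t *
        (?x s * of_bool (s + t \<in> ?M) + ?x t * of_bool (t + s \<in> ?M)))"
    unfolding coeff_sum_times by (simp only: split[symmetric])
  also have "\<dots> = (\<Sum>s\<in>keys p. \<Sum>t\<in>keys q. lookup p s * (?x s * (lookup q t * of_bool (s + t \<in> ?M))))
     + (\<Sum>s\<in>keys p. \<Sum>t\<in>keys q. lookup q t * (?x t * (lookup p s * of_bool (t + s \<in> ?M))))"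
    by (simp only: distrib_left sum.distrib mult_ac)
  also have "(\<Sum>s\<in>keys p. \<Sum>t\<in>keys q. lookup q t * (?x t * (lookup p s * of_bool (t + s \<in> ?M)))) =
      (\<Sum>t\<in>keys q. \<Sum>s\<in>keys p. lookup q t * (?x t * (lookup p s * of_bool (t + s \<in> ?M))))"
    by (rule sum.swap)
  also have "(\<Sum>s\<in>keys p. \<Sum>t\<in>keys q.
        lookup p s * (?x s * (lookup q t * of_bool (s + t \<in> ?M))))
      = coeff_sum ?M p * lookup q 0"
    by (simp only: half[OF q] sum_distrib_left[symmetric]) (simp only: coeff_sum_def sum_distrib_right mult.assoc)
  also have "(\<Sum>t\<in>keys q. \<Sum>s\<in>keys p.
        lookup q t * (?x t * (lookup p s * of_bool (t + s \<in> ?M))))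
      = coeff_sum ?M q * lookup p 0"
    by (simp only: half[OF p] sum_distrib_left[symmetric]) (simp only: coeff_sum_def sum_distrib_right mult.assoc)
  finally show ?thesis by (simp only: mult.commute)
qed

section \<open>Elements that every multi-homogeneous generating set contains\<close>

text \<open>A generator in which \<open>x\<^sub>i y\<^sub>i\<close> occurs has multi-degree \<open>2\<close> at \<open>i\<close> and \<open>0\<close> elsewhere; of
  \<open>x\<^sub>i\<^sup>2\<close>, \<open>x\<^sub>i y\<^sub>i\<close> and \<open>y\<^sub>i\<^sup>2\<close> only the second is balanced.\<close>
lemma generators_contain_Q:
  fixes G :: "'k::alg_closed_field mpoly set"
  assumes G: "generates G (invariants m)" and hom: "\<And>f. f \<in> G \<Longrightarrow> multihomogeneous m f" and i: "i \<in> {1..m}"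
  shows "\<exists>c. c \<noteq> 0 \<and> Const c * Q_inv i \<in> G"
proof -
  let ?q = "X i + Y i"
  have "\<exists>g\<in>G. g \<in> invariants m \<and> (\<exists>t\<in>keys g. t \<in> {?q})"
  proof (rule exists_generator_detected[OF G])
    show "0 \<notin> {?q}" by (auto dest: arg_cong[of _ _ xdeg])
    show "(Q_inv i :: 'k mpoly) \<in> invariants m" using i by (rule Q_inv_in_invariants)
    show "coeff_sum {?q} (Q_inv i :: 'k mpoly) \<noteq> 0" by (simp add: Q_inv_eq)
  qed (auto intro!: coeff_sum_Q_inv_derivation simp: invariants_iff)
  then obtain g where g: "g \<in> G" "g \<in> invariants m" "?q \<in> keys g" by blast
  have only: "t = ?q" if t: "t \<in> keys g" for t
  proof -
    have r: "ring_mono m t" and b: "xdeg t = ydeg t"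
      using g(2) t by (auto simp: invariants_iff poly_ring_def ring_mono_def)
    have "mono_multideg t j = mono_multideg ?q j" if "j \<in> {1..m}" for j
      using hom[OF g(1)] g(3) t that unfolding multihomogeneous_def by blast
    then have deg: "mono_multideg t j = (if j = i then 2 else 0)" for j
    proof (cases "j \<in> {1..m}")
      case False
      then have "VX j \<notin> keys t" "VY j \<notin> keys t"
        using r by (auto simp: ring_mono_def)
      then show ?thesis using False i by (auto simp: mono_multideg_def in_keys_iff)
    qed (auto simp: mono_multideg_def lookup_add lookup_single when_def)
    have eq: "t = single (VX i) (lookup t (VX i)) + single (VY i) (lookup t (VY i))"
    proof (rule poly_mapping_eqI)
      fix v show "lookup t v =
          lookup (single (VX i) (lookup t (VX i)) + single (VY i) (lookup t (VY i))) v"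
        using deg[of "vec_index v"] by (cases v) (auto simp: lookup_add lookup_single when_def mono_multideg_def split: if_splits)
    qed
    have "lookup t (VX i) = lookup t (VY i)"
      using b arg_cong[OF eq, of xdeg] arg_cong[OF eq, of ydeg] by simp
    then have "lookup t (VX i) = 1" "lookup t (VY i) = 1"
      using deg[of i] by (auto simp: mono_multideg_def)
    then show ?thesis using eq by simp
  qed
  have "Const (lookup g ?q) * Q_inv i = g"
  proof (rule poly_mapping_eqI)
    fix t show "lookup (Const (lookup g ?q) * Q_inv i) t = lookup g t"
      using only[of t] by (cases "t = ?q") (auto simp: Q_inv_eq lookup_single when_def in_keys_iff)
  qed
  then show ?thesis using g(1,3) by (metis in_keys_iff)
qed

text \<open>The functional for the support \<open>D\<close> of \<open>\<alpha>\<close> is non-zero because \<open>D\<close>, having even cardinality, splits into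
  two halves \<open>I\<close> and \<open>J\<close>: only one of the two terms of the orbit sum of \<open>x\<^sub>I y\<^sub>J\<close> contains \<open>x\<^sub>d\<close> when
  \<open>d \<in> I\<close>.\<close>
lemma generators_contain_multidegree:
  fixes G :: "'k::alg_closed_field mpoly set"
  assumes two: "(2::'k) = 0"
    and G: "generates G (invariants m)" and hom: "\<And>f. f \<in> G \<Longrightarrow> multihomogeneous m f"
    and \<alpha>: "\<forall>i\<in>{1..m}. \<alpha> i \<in> {0, 1}"
    and pos: "card {i \<in> {1..m}. \<alpha> i = 1} > 0" and ev: "even (card {i \<in> {1..m}. \<alpha> i = 1})"
  shows "\<exists>f\<in>G. has_multidegree m f \<alpha>"
proof -
  define D where "D = {i \<in> {1..m}. \<alpha> i = 1}"
  obtain s where s: "card D = 2 * s" using ev by (auto simp: D_def elim: evenE)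
  then have "s > 0" using pos by (simp add: D_def)
  have finD: "finite D" and D: "D \<subseteq> {1..m}" by (auto simp: D_def)
  obtain I where I: "I \<subseteq> D" "card I = s" using obtain_subset_with_card_n[of s D] s by auto
  have fin: "finite I" "finite (D - I)" using I(1) finD by (auto intro: finite_subset)
  have "card (D - I) = s" using I s finD by (simp add: card_Diff_subset fin)
  obtain d where d: "d \<in> I" using I(2) \<open>s > 0\<close> by fastforce
  define t where "t = (\<Sum>i\<in>I. X i) + (\<Sum>j\<in>D - I. Y j)"
  let ?M = "squarefree_monos D d"
  have t: "t \<in> ?M" using I(1) d fin
    by (auto simp: squarefree_monos_def t_def mono_multideg_def lookup_add)
  have t': "swap_mono t \<notin> ?M" using d fin
    by (auto simp: squarefree_monos_def t_def lookup_add)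
  have "\<exists>g\<in>G. g \<in> invariants m \<and> (\<exists>t\<in>keys g. t \<in> ?M)"
  proof (rule exists_generator_detected[OF G])
    show "0 \<notin> ?M" by (simp add: squarefree_monos_def)
    show "(orbit_sum t :: 'k mpoly) \<in> invariants m"
    proof (rule orbit_sum_in_invariants)
      show "xdeg t = ydeg t" using I(2) \<open>card (D - I) = s\<close> by (simp add: t_def xdeg_sum ydeg_sum)
      show "ring_mono m t" using I(1) fin D
        by (auto simp: t_def ring_mono_def in_keys_iff lookup_add subset_iff split: var.splits)
    qed
    show "coeff_sum ?M (orbit_sum t :: 'k mpoly) \<noteq> 0"
      using t t' by (simp add: orbit_sum_def coeff_sum_add)
  qed (auto intro!: coeff_sum_squarefree_derivation[OF two] simp: invariants_iff)
  then obtain g u where g: "g \<in> G" "u \<in> keys g" "u \<in> ?M" by blast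
  have "mono_multideg v i = \<alpha> i" if "v \<in> keys g" "i \<in> {1..m}" for v i
  proof -
    have "mono_multideg v i = mono_multideg u i"
      using hom[OF g(1)] g(2) that unfolding multihomogeneous_def by blast
    also have "\<dots> = \<alpha> i" using g(3) \<alpha> that(2) by (auto simp: squarefree_monos_def D_def)
    finally show ?thesis .
  qed
  moreover have "g \<noteq> 0" using g(2) by auto
  ultimately show ?thesis using g(1) by (auto simp: has_multidegree_def)
qed

section \<open>Minimality\<close>

lemma keys_orbit_sum_disjoint:
  assumes "swap_mono t \<noteq> t"
  shows "keys (orbit_sum t :: 'k::comm_ring_1 mpoly) = {t, swap_mono t}"
  using assms by (auto simp: in_keys_iff orbit_sum_def lookup_add lookup_single when_def split: if_splits)

lemma B_inv_multidegree:
  assumes "distinct (il @ jl)" "il \<noteq> []"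
  shows "has_multidegree m (B_inv il jl :: 'k::comm_ring_1 mpoly) (\<lambda>i. of_bool (i \<in> set (il @ jl)))"
proof -
  define t where "t = (\<Sum>i\<in>set il. X i) + (\<Sum>j\<in>set jl. Y j)"
  obtain d where "d \<in> set il" "d \<notin> set jl" using assms by (cases il) auto
  then have "lookup t (VX d) \<noteq> lookup (swap_mono t) (VX d)"
    by (simp add: t_def lookup_add)
  then have "swap_mono t \<noteq> t" by metis
  then have k: "keys (B_inv il jl :: 'k mpoly) = {t, swap_mono t}"
    using assms by (simp add: B_inv_eq_orbit_sum keys_orbit_sum_disjoint flip: t_def)
  have "mono_multideg t i = of_bool (i \<in> set (il @ jl))" for i
    using assms by (auto simp: t_def mono_multideg_def lookup_add)
  then show ?thesis using k by (auto simp: has_multidegree_def)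
qed

lemma Q_inv_multidegree:
  "has_multidegree m (Q_inv i :: 'k::comm_ring_1 mpoly) (\<lambda>j. if j = i then 2 else 0)"
  by (auto simp: has_multidegree_def Q_inv_eq mono_multideg_def lookup_add lookup_single when_def
     simp flip: keys_eq_empty)

lemma has_multidegree_unique:
  "has_multidegree m p \<alpha> \<Longrightarrow> has_multidegree m p \<beta> \<Longrightarrow> i \<in> {1..m} \<Longrightarrow> \<alpha> i = \<beta> i"
  unfolding has_multidegree_def by (metis all_not_in_conv keys_eq_empty)

lemma gens_cases:
  assumes "g \<in> gens m"
  obtains (Q) i where "i \<in> {1..m}" "g = Q_inv i"
  | (B) il jl where "g = B_inv il jl" "length il = length jl" "il \<noteq> []" "sorted_wrt (<) (il @ jl)" "set (il @ jl) \<subseteq> {1..m}"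
  using assms unfolding gens_def by fastforce

text \<open>The multi-degree of \<open>Q\<^sub>i\<close> has an entry \<open>2\<close>, that of a \<open>B\<close> only entries \<open>0\<close> and \<open>1\<close>. In the
  latter case the support, sorted and cut in the middle, gives back the two index lists.\<close>
lemma gens_determined_by_multidegree:
  fixes g h :: "'k::comm_ring_1 mpoly"
  assumes "g \<in> gens m" "h \<in> gens m" "has_multidegree m g \<alpha>" "has_multidegree m h \<alpha>"
  shows "g = h"
proof -
  have Q: "\<alpha> j = (if j = i then 2 else 0)" if "has_multidegree m (Q_inv i :: 'k mpoly) \<alpha>" "j \<in> {1..m}" for i j
    using has_multidegree_unique[OF that(1) Q_inv_multidegree that(2)] .
  have B: "\<alpha> j = of_bool (j \<in> set (il @ jl))"
    if "has_multidegree m (B_inv il jl :: 'k mpoly) \<alpha>" "sorted_wrt (<) (il @ jl)" "il \<noteq> []" "j \<in> {1..m}" for il jl j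
    using that by (intro has_multidegree_unique[OF that(1) B_inv_multidegree that(4)]) (auto simp: strict_sorted_iff)
  have BB: "B_inv il jl = (B_inv il' jl' :: 'k mpoly)"
    if "length il = length jl" "length il' = length jl'" and srt: "sorted_wrt (<) (il @ jl)" "sorted_wrt (<) (il' @ jl')"
      "set (il @ jl) = set (il' @ jl')" for il jl il' jl' :: "nat list"
  proof -
    have "il @ jl = il' @ jl'" using strict_sorted_equal[OF srt(2,1,3)] .
    moreover from this have "length il = length il'" using that(1,2) by (metis add_self_div_2 length_append)
    ultimately show ?thesis by simp
  qed
  show ?thesis using assms(1)
  proof (cases rule: gens_cases)
    case g: (Q i)
    from assms(2) show ?thesis
    proof (cases rule: gens_cases)
      case h: (Q j)
      then show ?thesis using Q[of i i] Q[of j i] assms(3,4) g by (auto split: if_splits)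
    next
      case h: (B il jl)
      then show ?thesis using Q[of i i] B[of il jl i] assms(3,4) g by (auto simp: of_bool_def split: if_splits)
    qed
  next
    case g: (B il jl)
    from assms(2) show ?thesis
    proof (cases rule: gens_cases)
      case h: (Q i)
      then show ?thesis using Q[of i i] B[of il jl i] assms(3,4) g by (auto simp: of_bool_def split: if_splits)
    next
      case h: (B il' jl')
      have "j \<in> set (il @ jl) \<longleftrightarrow> j \<in> set (il' @ jl')" if "j \<in> {1..m}" for j
        using B[of il jl j] B[of il' jl' j] g h assms(3,4) that by (metis of_bool_eq_iff)
      then have "set (il @ jl) = set (il' @ jl')" using g(5) h(5) by blast
      then show ?thesis using BB g h by metis
    qed
  qed
qed

lemma multihomogeneous_gens: "g \<in> gens m \<Longrightarrow> multihomogeneous m (g :: 'k::comm_ring_1 mpoly)"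
proof -
  have hom: "multihomogeneous m p" if "has_multidegree m p \<alpha>" for p :: "'k mpoly" and \<alpha>
    using that by (auto simp: has_multidegree_def multihomogeneous_def)
  assume "g \<in> gens m"
  then show ?thesis
    by (cases rule: gens_cases) (auto intro: hom[OF Q_inv_multidegree] hom[OF B_inv_multidegree] simp: strict_sorted_iff)
qed

theorem theorem2p2:
  fixes m :: nat
  assumes "CHAR('k::alg_closed_field) = 2"
    and "m \<ge> 1"
  shows "generates (gens m) (invariants m :: 'k mpoly set) \<and>
         minimally_generates (gens m) (invariants m :: 'k mpoly set) \<and>
         (\<forall>G :: 'k mpoly set.
           generates G (invariants m) \<and> (\<forall>f \<in> G. multihomogeneous m f) \<longrightarrow>
             (\<forall>i \<in> {1..m}. \<exists>c. c \<noteq> 0 \<and> Const c * Q_inv i \<in> G) \<and>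
             (\<forall>\<alpha> :: nat \<Rightarrow> nat.
                (\<forall>i \<in> {1..m}. \<alpha> i \<in> {0, 1}) \<and>
                card {i \<in> {1..m}. \<alpha> i = 1} > 0 \<and> even (card {i \<in> {1..m}. \<alpha> i = 1}) \<longrightarrow>
                (\<exists>f \<in> G. has_multidegree m f \<alpha>)))"
proof (intro conjI)
  have two: "(2::'k) = 0"
    using of_nat_CHAR[where 'a = 'k] assms(1) by simp
  show gen: "generates (gens m) (invariants m :: 'k mpoly set)" by (rule generates_gens)
  show "\<forall>G :: 'k mpoly set.
           generates G (invariants m) \<and> (\<forall>f \<in> G. multihomogeneous m f) \<longrightarrow>
             (\<forall>i \<in> {1..m}. \<exists>c. c \<noteq> 0 \<and> Const c * Q_inv i \<in> G) \<and>
             (\<forall>\<alpha> :: nat \<Rightarrow> nat.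
                (\<forall>i \<in> {1..m}. \<alpha> i \<in> {0, 1}) \<and>
                card {i \<in> {1..m}. \<alpha> i = 1} > 0 \<and> even (card {i \<in> {1..m}. \<alpha> i = 1}) \<longrightarrow>
                (\<exists>f \<in> G. has_multidegree m f \<alpha>))"
  proof (intro allI impI conjI ballI)
    fix G :: "'k mpoly set"
    assume G: "generates G (invariants m) \<and> (\<forall>f \<in> G. multihomogeneous m f)"
    show "\<exists>c. c \<noteq> 0 \<and> Const c * Q_inv i \<in> G" if "i \<in> {1..m}" for i
      using generators_contain_Q[of G m i] G that by blast
    show "\<exists>f \<in> G. has_multidegree m f \<alpha>"
      if "(\<forall>i \<in> {1..m}. \<alpha> i \<in> {0, 1}) \<and> card {i \<in> {1..m}. \<alpha> i = 1} > 0 \<and>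
          even (card {i \<in> {1..m}. \<alpha> i = 1})" for \<alpha>
      by (rule generators_contain_multidegree[OF two]) (use G that in blast)+
  qed
  show "minimally_generates (gens m) (invariants m :: 'k mpoly set)"
    unfolding minimally_generates_def
  proof (intro conjI allI impI notI gen)
    fix H :: "'k mpoly set" assume H: "H \<subset> gens m" "generates H (invariants m)"
    have hom: "multihomogeneous m f" if "f \<in> H" for f using H(1) that multihomogeneous_gens by blast
    (* H has an element in the multi-degree of the missing generator g, but g is the only one in gens m. *)
    obtain g where g: "g \<in> gens m" "g \<notin> H" using H(1) by blast
    have "\<exists>\<alpha>. has_multidegree m g \<alpha> \<and> (\<exists>h\<in>H. has_multidegree m h \<alpha>)"
      using g(1)
    proof (cases rule: gens_cases)
      case (Q i)
      obtain c where c: "c \<noteq> 0" "Const c * Q_inv i \<in> H"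
        using generators_contain_Q[OF H(2) hom Q(1)] by blast
      have "keys (Const c * Q_inv i) = keys (Q_inv i :: 'k mpoly)"
        using c(1) by (auto simp: in_keys_iff)
      then have "has_multidegree m (Const c * Q_inv i) (\<lambda>j. if j = i then 2 else 0)"
        using Q_inv_multidegree[of m i, where 'k = 'k] by (simp add: has_multidegree_def flip: keys_eq_empty)
      then show ?thesis using c(2) Q(2) Q_inv_multidegree by blast
    next
      case (B il jl)
      let ?\<alpha> = "\<lambda>i. of_bool (i \<in> set (il @ jl)) :: nat"
      have d: "distinct (il @ jl)" using B(4) by (simp add: strict_sorted_iff)
      have "{i \<in> {1..m}. ?\<alpha> i = 1} = set (il @ jl)" using B(5) by auto
      then have card: "card {i \<in> {1..m}. ?\<alpha> i = 1} = 2 * length il"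
        using distinct_card[OF d] B(2) by simp
      have "\<exists>h\<in>H. has_multidegree m h ?\<alpha>"
        by (rule generators_contain_multidegree[OF two H(2) hom]) (use card B(3) in auto)
      then show ?thesis using B_inv_multidegree[OF d B(3)] B(1) by blast
    qed
    then show False using gens_determined_by_multidegree[OF g(1)] H(1) g(2) by blast
  qed
qed

end
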